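(* Let $F=(F,\mathcal T,\nu,\mathcal G)$ be a $\nu$-semifield$^\dagger$ and let $\Lambda=\{\lambda_1,\dots,\lambda_n\}$. There is a $1:1$, order-reversing correspondence $$\{1^\nu\text{-sets of }F^{(n)}\}\longrightarrow\{\mathcal K\text{-kernels of }\overline{F(\Lambda)}\},\qquad Z\mapsto \mathcal Kern(Z),$$ whose reverse map is given by $K\mapsto 1_{\mathrm{loc}}(K)$.
   Context: **$\nu$-structures.** A semiring$^\dagger$ is a commutative semiring with unit $1$, not required to have a zero (and containing $r_0,r_1$ with $r_0+r_1=1$). A $\nu$-domain$^\dagger$ is a quadruple $(R,\mathcal T,\nu,\mathcal G)$ with $R$ a semiring$^\dagger$, $\mathcal T\subset R$ a cancellative multiplicative submonoid (tangible elements), $\mathcal G$ an ideal of $R$ (ghost elements) with a partial order, and $\nu:R\to\mathcal G$ an idempotent homomorphism with $\nu|_{\mathcal T}$ onto, such that $a+b=a$ if $\nu(a)>\nu(b)$ and $a+b=\nu(a)$ if $\nu(a)=\nu(b)$. It is a $\nu$-semifield$^\dagger$ if $\mathcal T$ is an abelian group. Write $a^\nu=\nu(a)$; $a\cong_\nu b$ means $a^\nu=b^\nu$; $a\ge_\nu b$ means $a^\nu\ge b^\nu$. Set $a^*=a^{-1}$ and $(a^\nu)^*=(a^{-1})^\nu$ for $a\in\mathcal T$. **Rational functions.** $\overline{F[\Lambda]}$ is the semiring$^\dagger$ of functions $F^{(n)}\to F$ defined by polynomials over $F$ in $\lambda_1,\dots,\lambda_n$, and $\overline{\mathcal T[\Lambda]}$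 its subset defined by polynomials with tangible coefficients. $\overline{F(\Lambda)}$ is the localization of $\overline{F[\Lambda]}$ at $\overline{\mathcal T[\Lambda]}$; its elements $h/g$ are regarded as functions $\mathbf a\mapsto h(\mathbf a)g(\mathbf a)^*$ on $F^{(n)}$, with pointwise operations. **$1^\nu$-sets and $\mathcal K$-kernels.** For $S\subseteq\overline{F(\Lambda)}$, $1_{\mathrm{loc}}(S)=\{\mathbf a\in F^{(n)}: f(\mathbf a)\cong_\nu 1\ \forall f\in S\}$. A $1^\nu$-set is a subset of $F^{(n)}$ of the form $1_{\mathrm{loc}}(S)$. For $Z\subseteq F^{(n)}$, $\mathcal Kern(Z)=\{f\in\overline{F(\Lambda)}: f(\mathbf a)\cong_\nu 1\ \forall\mathbf a\in Z\}$. A $\mathcal K$-kernel of $\overline{F(\Lambda)}$ is a set of the form $\mathcal Kern(Z)$ with $Z$ a $1^\nu$-set. Both collections are ordered by inclusion. *)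

theory Defs
  imports "HOL-Analysis.Finite_Cartesian_Product"
begin

section \<open>\<open>\<nu>\<close>-domains and \<open>\<nu>\<close>-semifields\<close>

text \<open>
  The whole type \<^typ>\<open>'a\<close> is the underlying semiring. The sort
  \<open>{comm_semiring, comm_monoid_mult}\<close> is a commutative semiring with unit in which no zero is
  required. The relation \<open>le\<close> is the order on the ghosts: \<open>(x, y) \<in> le\<close> means \<open>x \<le> y\<close>.
\<close>

locale nu_domain =
  fixes T :: "'a :: {comm_semiring, comm_monoid_mult} set"
    and nu :: "'a \<Rightarrow> 'a"
    and G :: "'a set"
    and le :: "('a \<times> 'a) set"
  assumes sum_eq_one: "\<exists>r0 r1 :: 'a. r0 + r1 = 1"
    and one_tangible: "1 \<in> T"
    and mult_tangible: "\<lbrakk>a \<in> T; b \<in> T\<rbrakk> \<Longrightarrow> a * b \<in> T"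
    and cancel_tangible: "\<lbrakk>a \<in> T; b \<in> T; c \<in> T; a * b = a * c\<rbrakk> \<Longrightarrow> b = c"
    and add_ghost: "\<lbrakk>a \<in> G; b \<in> G\<rbrakk> \<Longrightarrow> a + b \<in> G"
    and mult_ghost: "a \<in> G \<Longrightarrow> r * a \<in> G"
    and ghost_order: "partial_order_on G le"
    and nu_ghost: "nu a \<in> G"
    and nu_add: "nu (a + b) = nu a + nu b"
    and nu_mult: "nu (a * b) = nu a * nu b"
    and nu_idem: "nu (nu a) = nu a"
    and nu_onto: "nu ` T = G"
    and add_dominant: "\<lbrakk>(nu b, nu a) \<in> le; nu b \<noteq> nu a\<rbrakk> \<Longrightarrow> a + b = a"
    and add_equiv: "nu a = nu b \<Longrightarrow> a + b = nu a"

locale nu_semifield = nu_domain +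
  assumes tangible_inverse: "a \<in> T \<Longrightarrow> \<exists>b\<in>T. a * b = 1"

definition nu_equiv :: "('a \<Rightarrow> 'a) \<Rightarrow> 'a \<Rightarrow> 'a \<Rightarrow> bool" where
  "nu_equiv nu a b \<longleftrightarrow> nu a = nu b"

definition tangible_inv :: "'a :: comm_monoid_mult set \<Rightarrow> 'a \<Rightarrow> 'a" where
  "tangible_inv T a = (THE b. b \<in> T \<and> a * b = 1)"

text \<open>
  The operation \<open>*\<close>: the inverse \<open>a\<^sup>-\<^sup>1\<close> of a tangible \<open>a\<close>, and \<open>\<nu> (a\<^sup>-\<^sup>1)\<close> at the ghost \<open>\<nu> a\<close>; see
  the lemmas \<open>star_tangible\<close> and \<open>star_ghost\<close> below. The axioms do not force every element to be
  tangible or ghost; an element \<open>x\<close> that is neither gets the value that belongs to \<open>\<nu> x\<close>.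
\<close>

definition star :: "'a :: comm_monoid_mult set \<Rightarrow> ('a \<Rightarrow> 'a) \<Rightarrow> 'a \<Rightarrow> 'a" where
  "star T nu x =
     (if x \<in> T then tangible_inv T x
      else nu (tangible_inv T (SOME t. t \<in> T \<and> nu t = nu x)))"

context nu_semifield
begin

lemma tangible_inv:
  assumes "a \<in> T"
  shows "tangible_inv T a \<in> T" "a * tangible_inv T a = 1"
proof -
  have "\<exists>!b. b \<in> T \<and> a * b = 1"
    using tangible_inverse[OF assms] cancel_tangible[OF assms] by metis
  from theI'[OF this] show "tangible_inv T a \<in> T" "a * tangible_inv T a = 1"
    unfolding tangible_inv_def by auto
qed

lemma star_tangible: "a \<in> T \<Longrightarrow> star T nu a = tangible_inv T a"
  by (simp add: star_def)

lemma nu_tangible_inv_cong: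
  assumes "a \<in> T" "b \<in> T" "nu a = nu b"
  shows "nu (tangible_inv T a) = nu (tangible_inv T b)"
proof -
  let ?a = "tangible_inv T a" and ?b = "tangible_inv T b"
  have "nu ?a = nu (?a * (b * ?b))"
    using assms tangible_inv(2) by simp
  also have "\<dots> = nu (?b * (a * ?a))"
    using assms(3) by (simp add: nu_mult mult_ac)
  also have "\<dots> = nu ?b"
    using assms tangible_inv(2) by simp
  finally show ?thesis .
qed

lemma star_ghost:
  assumes "a \<in> T"
  shows "star T nu (nu a) = nu (tangible_inv T a)"
proof (cases "nu a \<in> T")
  case True
  define u where "u = tangible_inv T (nu a)"
  have "1 \<in> G"
    using mult_ghost[OF nu_ghost[of a], of u] tangible_inv[OF True]
    by (simp add: u_def mult.commute)
  then have "x \<in> G" for x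
    using mult_ghost[of 1 x] by simp
  then have "nu x = x" for x
    using nu_onto nu_idem by (metis imageE)
  then show ?thesis
    using assms by (simp add: star_tangible)
next
  case False
  let ?t = "SOME t. t \<in> T \<and> nu t = nu (nu a)"
  have "?t \<in> T \<and> nu ?t = nu (nu a)"
    by (rule someI[of _ a]) (simp add: assms nu_idem)
  then show ?thesis
    using False nu_tangible_inv_cong[OF _ assms, of ?t] by (simp add: star_def nu_idem)
qed

lemma nu_star: "nu (x * star T nu x) = nu 1"
proof (cases "x \<in> T")
  case True
  then show ?thesis by (simp add: star_tangible tangible_inv)
next
  case False
  let ?t = "SOME t. t \<in> T \<and> nu t = nu x"
  have "\<exists>t. t \<in> T \<and> nu t = nu x"
    using nu_onto nu_ghost[of x] by (metis imageE nu_idem)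
  then have "?t \<in> T \<and> nu ?t = nu x" by (rule someI_ex)
  then have "nu x * nu (tangible_inv T ?t) = nu 1"
    using tangible_inv(2)[of ?t] by (metis nu_mult)
  then show ?thesis using False by (simp add: star_def nu_mult nu_idem)
qed

end

section \<open>Polynomial and rational functions\<close>

text \<open>
  Without a zero the library's \<^const>\<open>sum\<close> is not available. The sum over a nonempty finite set
  is obtained by folding from \<^const>\<open>None\<close>, which acts as an adjoined neutral element.
\<close>

definition add_option :: "'b :: ab_semigroup_add \<Rightarrow> 'b option \<Rightarrow> 'b option" where
  "add_option x s = (case s of None \<Rightarrow> Some x | Some y \<Rightarrow> Some (x + y))"

definition nonempty_sum :: "('i \<Rightarrow> 'b :: ab_semigroup_add) \<Rightarrow> 'i set \<Rightarrow> 'b" where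
  "nonempty_sum f I = the (Finite_Set.fold (\<lambda>i. add_option (f i)) None I)"

lemma comp_fun_commute_add_option: "comp_fun_commute (\<lambda>i. add_option (f i))"
  by unfold_locales (auto simp: add_option_def fun_eq_iff add_ac split: option.splits)

lemma nonempty_sum_singleton: "nonempty_sum f {i} = f i"
proof -
  interpret comp_fun_commute "\<lambda>i. add_option (f i)" by (rule comp_fun_commute_add_option)
  show ?thesis by (simp add: nonempty_sum_def add_option_def)
qed

lemma nonempty_sum_insert:
  assumes "finite I" "I \<noteq> {}" "i \<notin> I"
  shows "nonempty_sum f (insert i I) = f i + nonempty_sum f I"
proof -
  interpret comp_fun_commute "\<lambda>i. add_option (f i)" by (rule comp_fun_commute_add_option)
  have "Finite_Set.fold (\<lambda>i. add_option (f i)) None I \<noteq> None"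
    using assms(1,2)
    by (induction I rule: finite_induct) (auto simp: add_option_def split: option.splits)
  then show ?thesis
    using assms by (auto simp: nonempty_sum_def add_option_def)
qed

text \<open>
  The function on \<open>F\<^sup>(\<^sup>n\<^sup>)\<close> defined by the polynomial with support in the finite set \<open>I\<close> of exponent
  vectors and coefficients \<open>c\<close>. A polynomial is a nonempty sum of monomials with distinct
  exponents; distinctness matters, as a sum of two tangible coefficients may be a ghost.
\<close>

definition poly_fun ::
  "(('n \<Rightarrow> nat) \<Rightarrow> 'a) \<Rightarrow> ('n \<Rightarrow> nat) set
    \<Rightarrow> ('a :: {comm_semiring, comm_monoid_mult}) ^ 'n \<Rightarrow> 'a" where
  "poly_fun c I a = nonempty_sum (\<lambda>e. c e * (\<Prod>i\<in>UNIV. (a $ i) ^ e i)) I"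

definition poly_funs_over ::
  "'a set \<Rightarrow> (('a :: {comm_semiring, comm_monoid_mult}) ^ 'n \<Rightarrow> 'a) set" where
  "poly_funs_over C = {poly_fun c I | c I. finite I \<and> I \<noteq> {} \<and> (\<forall>e\<in>I. c e \<in> C)}"

text \<open>The fractions \<open>h / g\<close> as functions, with \<open>h\<close> arbitrary and \<open>g\<close> having tangible coefficients.\<close>

definition rational_funs ::
  "'a set \<Rightarrow> ('a \<Rightarrow> 'a) \<Rightarrow> (('a :: {comm_semiring, comm_monoid_mult}) ^ 'n \<Rightarrow> 'a) set" where
  "rational_funs T nu =
     {\<lambda>a. h a * star T nu (g a) | h g. h \<in> poly_funs_over UNIV \<and> g \<in> poly_funs_over T}"

section \<open>\<open>1\<^sup>\<nu>\<close>-sets and \<open>K\<close>-kernels\<close>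

definition one_loc ::
  "('a \<Rightarrow> 'a) \<Rightarrow> ('a ^ 'n \<Rightarrow> 'a :: {comm_semiring, comm_monoid_mult}) set \<Rightarrow> ('a ^ 'n) set" where
  "one_loc nu S = {a. \<forall>f\<in>S. nu_equiv nu (f a) 1}"

definition one_nu_sets ::
  "'a set \<Rightarrow> ('a \<Rightarrow> 'a) \<Rightarrow> (('a :: {comm_semiring, comm_monoid_mult}) ^ 'n) set set" where
  "one_nu_sets T nu = {one_loc nu S | S. S \<subseteq> rational_funs T nu}"

definition Kern ::
  "'a set \<Rightarrow> ('a \<Rightarrow> 'a) \<Rightarrow> ('a ^ 'n) set
    \<Rightarrow> (('a :: {comm_semiring, comm_monoid_mult}) ^ 'n \<Rightarrow> 'a) set" where
  "Kern T nu Z = {f \<in> rational_funs T nu. \<forall>a\<in>Z. nu_equiv nu (f a) 1}"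

definition K_kernels ::
  "'a set \<Rightarrow> ('a \<Rightarrow> 'a)
    \<Rightarrow> (('a :: {comm_semiring, comm_monoid_mult}) ^ 'n \<Rightarrow> 'a) set set" where
  "K_kernels T nu = {Kern T nu Z | Z. Z \<in> one_nu_sets T nu}"

end

theory Submission
  imports Defs
begin

text \<open>The relation \<open>nu (f a) = nu 1\<close> between points and rational functions
  induces an antitone Galois connection, with \<open>Kern\<close> and \<open>one_loc\<close> as its
  two polars. The sets in question are the closed ones on each side, so the polars restrict to
  mutually inverse bijections. The round trips are \<open>one_loc_Kern\<close> and
  \<open>Kern_one_loc\<close>.\<close>

lemma Kern_antimono: "Z \<subseteq> Z' \<Longrightarrow> Kern T nu Z' \<subseteq> Kern T nu Z"
  by (auto simp: Kern_def)

lemma one_loc_antimono: "S \<subseteq> S' \<Longrightarrow> one_loc nu S' \<subseteq> one_loc nu S"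
  by (auto simp: one_loc_def)

text \<open>Write \<open>Z = one_loc nu S\<close>. Since \<open>S\<close> consists of rational
  functions, it lies in \<open>Kern T nu Z\<close>, so a common solution of the kernel solves
  \<open>S\<close> and is in \<open>Z\<close>.\<close>

lemma one_loc_Kern:
  assumes "Z \<in> one_nu_sets T nu"
  shows "one_loc nu (Kern T nu Z) = Z"
  using assms by (auto simp: one_nu_sets_def one_loc_def Kern_def)

text \<open>With \<open>K = Kern T nu Z\<close> for a \<open>Z\<close> in
  \<open>one_nu_sets T nu\<close>, the previous lemma recovers \<open>Z\<close> from
  \<open>K\<close>.\<close>

lemma Kern_one_loc:
  assumes "K \<in> K_kernels T nu"
  shows "Kern T nu (one_loc nu K) = K"
  using assms by (auto simp: K_kernels_def one_loc_Kern)

theorem theorem5p3p6: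
  fixes T :: "'a :: {comm_semiring, comm_monoid_mult} set"
    and nu :: "'a \<Rightarrow> 'a"
    and G :: "'a set"
    and le :: "('a \<times> 'a) set"
  assumes "nu_semifield T nu G le"
  shows "bij_betw (Kern T nu) (one_nu_sets T nu :: ('a ^ 'n) set set) (K_kernels T nu)
    \<and> antimono_on (one_nu_sets T nu :: ('a ^ 'n) set set) (Kern T nu)
    \<and> bij_betw (one_loc nu) (K_kernels T nu) (one_nu_sets T nu :: ('a ^ 'n) set set)
    \<and> antimono_on (K_kernels T nu :: ('a ^ 'n \<Rightarrow> 'a) set set) (one_loc nu)
    \<and> (\<forall>Z \<in> (one_nu_sets T nu :: ('a ^ 'n) set set). one_loc nu (Kern T nu Z) = Z)
    \<and> (\<forall>K \<in> (K_kernels T nu :: ('a ^ 'n \<Rightarrow> 'a) set set). Kern T nu (one_loc nu K) = K)"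
proof (intro conjI ballI)
  show "bij_betw (Kern T nu) (one_nu_sets T nu :: ('a ^ 'n) set set) (K_kernels T nu)"
    by (rule bij_betw_byWitness[where f' = "one_loc nu"])
      (auto simp: one_loc_Kern Kern_one_loc K_kernels_def)
  show "bij_betw (one_loc nu) (K_kernels T nu) (one_nu_sets T nu :: ('a ^ 'n) set set)"
    by (rule bij_betw_byWitness[where f' = "Kern T nu"])
      (auto simp: one_loc_Kern Kern_one_loc K_kernels_def)
qed (auto intro!: monotone_onI Kern_antimono one_loc_antimono simp: one_loc_Kern Kern_one_loc)

end
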